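(* For a dcpo $P$, $\langle P,\mathrm{clsys}_P\rangle$ and $\langle P,\mathrm{dcclsys}_P\rangle$ are convex geometries.
   Context: A dcpo is a poset in which every directed (in particular nonempty) subset has a join. A closure operator on a poset is an increasing, ascending ($x\le\gamma(x)$), idempotent map from the poset to itself. A closure system in a poset $P$ is the fixpoint set of a closure operator on $P$; equivalently, a subset $C\subseteq P$ such that for every $x\in P$ the set $\{y\in C: y\ge x\}$ has a least element. A subset of $P$ is directed-closed if it contains the join of each of its directed subsets. For a dcpo $P$, the intersection of any set of closure systems in $P$ is a closure system in $P$, and likewise for directed-closed closure systems. For $X\subseteq P$, $\mathrm{clsys}_P(X)$ is the least closure system in $P$ including $X$, and $\mathrm{dcclsys}_P(X)$ is the least directed-closed closure system in $P$ including $X$; both $\mathrm{clsys}_P$ and $\mathrm{dcclsys}_P$ are closure operators on the powerset lattice $\mathcal{P}(P)$. A convex geometry is a pair $\langle E,\gamma\rangle$ where $E$ is a set and $\gamma$ is a closure operator on $\mathcal{P}(E)$ that is convex, i.e. satisfies the anti-exchange axiom: for every $A\subseteq E$ and all $x,y\in E$, if $x,y\notin\gamma(A)$, $x\ne y$ and $x\in\gamma(A\cup\{y\})$, then $y\notin\gamma(A\cup\{x\})$. (It is not required that $\gamma(\emptyset)=\emptyset$.) *)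

theory Defs
  imports "HOL-Algebra.Complete_Lattice"
begin

definition directed :: "('a, 'b) gorder_scheme \<Rightarrow> 'a set \<Rightarrow> bool" where
  "directed P D \<longleftrightarrow> D \<subseteq> carrier P \<and> D \<noteq> {} \<and>
     (\<forall>x\<in>D. \<forall>y\<in>D. \<exists>z\<in>D. x \<sqsubseteq>\<^bsub>P\<^esub> z \<and> y \<sqsubseteq>\<^bsub>P\<^esub> z)"

locale dcpo = partial_order P for P (structure) +
  assumes directed_join_exists: "directed P D \<Longrightarrow> \<exists>s. least P s (Upper P D)"

definition closure_operator :: "('a, 'b) gorder_scheme \<Rightarrow> ('a \<Rightarrow> 'a) \<Rightarrow> bool" where
  "closure_operator P \<gamma> \<longleftrightarrow> \<gamma> \<in> carrier P \<rightarrow> carrier P \<and>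
     isotone P P \<gamma> \<and> (\<forall>x\<in>carrier P. x \<sqsubseteq>\<^bsub>P\<^esub> \<gamma> x) \<and> idempotent P \<gamma>"

definition closure_system :: "('a, 'b) gorder_scheme \<Rightarrow> 'a set \<Rightarrow> bool" where
  "closure_system P C \<longleftrightarrow> (\<exists>\<gamma>. closure_operator P \<gamma> \<and> C = fps P \<gamma>)"

definition directed_closed :: "('a, 'b) gorder_scheme \<Rightarrow> 'a set \<Rightarrow> bool" where
  "directed_closed P C \<longleftrightarrow> C \<subseteq> carrier P \<and>
     (\<forall>D s. directed P D \<and> D \<subseteq> C \<and> least P s (Upper P D) \<longrightarrow> s \<in> C)"

(* LEAST is taken with respect to inclusion of sets. The two functions below are
   meaningful only if P is a dcpo and X is a subset of its carrier; otherwise the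
   least element need not exist and the value is unspecified. *)

definition clsys :: "('a, 'b) gorder_scheme \<Rightarrow> 'a set \<Rightarrow> 'a set" where
  "clsys P X = (LEAST C. closure_system P C \<and> X \<subseteq> C)"

definition dcclsys :: "('a, 'b) gorder_scheme \<Rightarrow> 'a set \<Rightarrow> 'a set" where
  "dcclsys P X = (LEAST C. closure_system P C \<and> directed_closed P C \<and> X \<subseteq> C)"

definition powerset_lattice :: "'a set \<Rightarrow> 'a set gorder" where
  "powerset_lattice E = \<lparr>carrier = Pow E, eq = (=), le = (\<subseteq>)\<rparr>"

definition anti_exchange :: "'a set \<Rightarrow> ('a set \<Rightarrow> 'a set) \<Rightarrow> bool" where
  "anti_exchange E \<gamma> \<longleftrightarrow>
     (\<forall>A\<subseteq>E. \<forall>x\<in>E. \<forall>y\<in>E. x \<notin> \<gamma> A \<and> y \<notin> \<gamma> A \<and> x \<noteq> y \<and> x \<in> \<gamma> (A \<union> {y})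
        \<longrightarrow> y \<notin> \<gamma> (A \<union> {x}))"

definition convex_geometry :: "'a set \<Rightarrow> ('a set \<Rightarrow> 'a set) \<Rightarrow> bool" where
  "convex_geometry E \<gamma> \<longleftrightarrow> closure_operator (powerset_lattice E) \<gamma> \<and> anti_exchange E \<gamma>"

end

theory Submission
  imports Defs
begin

text \<open>Intersections of closure systems in a dcpo are closure systems by Pataraia's argument: the
  ascending increasing maps that fix the intersection pointwise form a set closed under composition,
  hence directed, and their pointwise join is the closure operator sought. If \<open>C\<close> is a (directed-closed)
  closure system, then so is its union with a principal ideal, since an element outside the ideal has
  no upper bounds in it. Hence the elements added to \<open>\<gamma> A\<close> by adjoining \<open>y\<close> to \<open>A\<close> all lie below \<open>y\<close>,
  and anti-exchange follows from antisymmetry.\<close>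

section \<open>Closure systems in dcpos\<close>

context dcpo
begin

text \<open>The operator can be recovered from its fixpoints: \<open>\<gamma> x\<close> is the least
  fixpoint above \<open>x\<close>. This form allows a set to be recognised as a closure system
  without naming an operator, which is how intersections and unions with ideals are treated
  below.\<close>

lemma closure_system_iff_least:
  "closure_system P C \<longleftrightarrow>
    C \<subseteq> carrier P \<and> (\<forall>x\<in>carrier P. \<exists>c. least P c {y \<in> C. x \<sqsubseteq> y})" (is "_ \<longleftrightarrow> ?R")
proof
  assume "closure_system P C"
  then obtain \<gamma> where \<gamma>: "closure_operator P \<gamma>" and C: "C = fps P \<gamma>"
    by (auto simp: closure_system_def)
  have "least P (\<gamma> x) {y \<in> C. x \<sqsubseteq> y}" if x: "x \<in> carrier P" for x
    using x \<gamma> unfolding C least_def closure_operator_def isotone_def idempotent_def fps_def eq_is_equal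
    by (auto simp: Pi_iff) metis
  then show ?R
    using C by (auto simp: fps_def)
next
  assume R: ?R
  define \<gamma> where "\<gamma> x = (SOME c. least P c {y \<in> C. x \<sqsubseteq> y})" for x
  have \<gamma>: "least P (\<gamma> x) {y \<in> C. x \<sqsubseteq> y}" if "x \<in> carrier P" for x
    using R that unfolding \<gamma>_def by (metis someI_ex)
  have C: "\<gamma> x \<in> C" "\<gamma> x \<in> carrier P" "x \<sqsubseteq> \<gamma> x" if "x \<in> carrier P" for x
    using \<gamma>[OF that] by (auto simp: least_def)
  have le: "\<gamma> x \<sqsubseteq> y" if "x \<in> carrier P" "y \<in> C" "x \<sqsubseteq> y" for x y
    using \<gamma>[OF that(1)] that by (auto simp: least_def)
  have fixed: "\<gamma> y = y" if "y \<in> C" for y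
    using that R C le by (meson le_antisym le_refl subsetD)
  have "\<gamma> x \<sqsubseteq> \<gamma> y" if "x \<in> carrier P" "y \<in> carrier P" "x \<sqsubseteq> y" for x y
    using that C le[OF that(1), of "\<gamma> y"] le_trans[of x y "\<gamma> y"] by simp
  then have "isotone P P \<gamma>"
    using weak_partial_order_axioms by (simp add: isotone_def)
  moreover have "idempotent P \<gamma>"
    using C fixed by (simp add: idempotent_def eq_is_equal)
  ultimately have "closure_operator P \<gamma>"
    using C by (auto simp: closure_operator_def)
  moreover have "C = fps P \<gamma>"
  proof
    show "C \<subseteq> fps P \<gamma>"
      using R fixed by (auto simp: fps_def eq_is_equal)
    show "fps P \<gamma> \<subseteq> C"
    proof
      fix x assume "x \<in> fps P \<gamma>"
      then have "x \<in> carrier P" "\<gamma> x = x"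
        by (auto simp: fps_def eq_is_equal)
      then show "x \<in> C"
        using C(1) by metis
    qed
  qed
  ultimately show "closure_system P C"
    by (auto simp: closure_system_def)
qed

lemma closure_system_carrier: "closure_system P (carrier P)"
  unfolding closure_system_iff_least by (auto simp: least_def)

lemma directed_closed_carrier: "directed_closed P (carrier P)"
  by (auto simp: directed_closed_def)

text \<open>The pointwise join \<open>s\<close> of \<open>M\<close> is the greatest map in
  \<open>M\<close>, so following it by any of the given closure operators yields nothing larger. Its
  values are therefore fixed by all of them.\<close>

lemma closure_system_Inter:
  assumes "F \<noteq> {}" and F: "\<And>C. C \<in> F \<Longrightarrow> closure_system P C"
  shows "closure_system P (\<Inter>F)"
proof -
  let ?K = "\<Inter>F"
  \<comment> \<open>Here \<open>F \<noteq> {}\<close> matters: the intersection of the empty family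
    is \<open>UNIV\<close>.\<close>
  have K: "?K \<subseteq> carrier P"
    using assms closure_system_iff_least by blast
  define M where "M = {f \<in> carrier P \<rightarrow> carrier P.
    (\<forall>x\<in>carrier P. \<forall>y\<in>carrier P. x \<sqsubseteq> y \<longrightarrow> f x \<sqsubseteq> f y) \<and>
    (\<forall>x\<in>carrier P. x \<sqsubseteq> f x) \<and> (\<forall>k\<in>?K. f k = k)}"
  have M: "f x \<in> carrier P" "x \<sqsubseteq> f x" if "f \<in> M" "x \<in> carrier P" for f x
    using that by (auto simp: M_def)
  have M_mono: "f x \<sqsubseteq> f y" if "f \<in> M" "x \<in> carrier P" "y \<in> carrier P" "x \<sqsubseteq> y" for f x y
    using that by (auto simp: M_def)
  have M_fix: "f k = k" if "f \<in> M" "k \<in> ?K" for f k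
    using that unfolding M_def by blast
  have id: "(\<lambda>x. x) \<in> M"
    by (auto simp: M_def)
  have comp: "f \<circ> g \<in> M" if f: "f \<in> M" and g: "g \<in> M" for f g
  proof -
    have "x \<sqsubseteq> f (g x)" if "x \<in> carrier P" for x
      using that M[OF f] M[OF g] by (meson le_trans)
    then show ?thesis
      using M[OF f] M[OF g] M_mono[OF f] M_mono[OF g] M_fix[OF f] M_fix[OF g]
      unfolding M_def by auto
  qed
  have "directed P ((\<lambda>f. f x) ` M)" if x: "x \<in> carrier P" for x
    unfolding directed_def
  proof (intro conjI ballI)
    fix a b assume "a \<in> (\<lambda>f. f x) ` M" "b \<in> (\<lambda>f. f x) ` M"
    then obtain f g where fg: "f \<in> M" "g \<in> M" "a = f x" "b = g x"
      \<comment> \<open>The composite bounds both values: \<open>f x \<sqsubseteq> f (g x)\<close>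
        because \<open>f\<close> is increasing and \<open>x \<sqsubseteq> g x\<close>, while
        \<open>g x \<sqsubseteq> f (g x)\<close> because \<open>f\<close> is ascending.\<close>
      by auto
    then have "a \<sqsubseteq> (f \<circ> g) x" "b \<sqsubseteq> (f \<circ> g) x"
      using M M_mono x by auto
    then show "\<exists>z\<in>(\<lambda>f. f x) ` M. a \<sqsubseteq> z \<and> b \<sqsubseteq> z"
      using comp fg by blast
  qed (use id M x in auto)
  then have "\<forall>x\<in>carrier P. \<exists>s. least P s (Upper P ((\<lambda>f. f x) ` M))"
    by (simp add: directed_join_exists)
  from bchoice[OF this]
  obtain s where s: "\<And>x. x \<in> carrier P \<Longrightarrow> least P (s x) (Upper P ((\<lambda>f. f x) ` M))"
    by blast
  have s_closed: "s x \<in> carrier P" if "x \<in> carrier P" for x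
    using s[OF that] by simp
  have s_upper: "f x \<sqsubseteq> s x" if "f \<in> M" "x \<in> carrier P" for f x
    by (rule least_Upper_above[OF s]) (use that M in auto)
  have s_least: "s x \<sqsubseteq> b" if "x \<in> carrier P" "b \<in> carrier P" "\<And>f. f \<in> M \<Longrightarrow> f x \<sqsubseteq> b" for x b
    by (rule least_le[OF s]) (use that in \<open>auto intro!: Upper_memI\<close>)
  have s_mono: "s x \<sqsubseteq> s y" if "x \<in> carrier P" "y \<in> carrier P" "x \<sqsubseteq> y" for x y
  proof (rule s_least)
    fix f assume "f \<in> M"
    then show "f x \<sqsubseteq> s y"
      using le_trans[of "f x" "f y" "s y"] M_mono s_upper M(1) s_closed that by simp
  qed (use that s_closed in auto)
  have s_asc: "x \<sqsubseteq> s x" if "x \<in> carrier P" for x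
    using s_upper[OF id that] .
  have s_fix: "s k = k" if "k \<in> ?K" for k
  proof (rule le_antisym)
    show k: "k \<in> carrier P" using that K by blast
    show "s k \<sqsubseteq> k"
      by (rule s_least) (simp_all only: M_fix[OF _ that] k le_refl)
  qed (use that K s_asc s_closed in blast)+
  have "s \<in> M"
    unfolding M_def using s_closed s_mono s_asc s_fix by blast
  have s_mem: "s x \<in> ?K" if x: "x \<in> carrier P" for x
  proof
    fix C assume "C \<in> F"
    then obtain \<gamma> where \<gamma>: "closure_operator P \<gamma>" "C = fps P \<gamma>"
      using F by (auto simp: closure_system_def)
    \<comment> \<open>Elements of \<open>?K\<close> lie in \<open>C\<close>, the fixpoint set of
      \<open>\<gamma>\<close>, so \<open>\<gamma>\<close> fixes them. Then
      \<open>\<gamma> \<circ> s\<close> is in \<open>M\<close> as well, hence below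
      \<open>s\<close>.\<close>
    then have "\<gamma> \<in> M"
      using \<open>C \<in> F\<close>
      by (auto simp: M_def closure_operator_def isotone_def fps_def eq_is_equal)
    then have "\<gamma> (s x) \<sqsubseteq> s x" "s x \<sqsubseteq> \<gamma> (s x)" "\<gamma> (s x) \<in> carrier P"
      using s_upper[OF comp[OF _ \<open>s \<in> M\<close>] x] M s_closed[OF x] by auto
    then show "s x \<in> C"
      using \<gamma> s_closed[OF x] by (auto simp: fps_def eq_is_equal intro: le_antisym)
  qed
  have "least P (s x) {y \<in> ?K. x \<sqsubseteq> y}" if x: "x \<in> carrier P" for x
    unfolding least_def
  proof (intro conjI ballI)
    \<comment> \<open>Leastness comes from fixing \<open>?K\<close> pointwise:
      \<open>s x \<sqsubseteq> s y = y\<close>.\<close>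
    fix y assume "y \<in> {y \<in> ?K. x \<sqsubseteq> y}"
    then show "s x \<sqsubseteq> y"
      using s_mono[OF x, of y] s_fix[of y] K by auto
  next
    show "{y \<in> ?K. x \<sqsubseteq> y} \<subseteq> carrier P"
      using K by blast
    show "s x \<in> {y \<in> ?K. x \<sqsubseteq> y}"
      using s_mem[OF x] s_asc[OF x] by simp
  qed
  then show ?thesis
    using K closure_system_iff_least by blast
qed

lemma directed_closed_Inter:
  assumes "F \<noteq> {}" "\<And>C. C \<in> F \<Longrightarrow> directed_closed P C"
  shows "directed_closed P (\<Inter>F)"
  using assms unfolding directed_closed_def by blast

text \<open>If \<open>x \<sqsubseteq> y\<close>, then \<open>x\<close> itself is the least candidate
  above \<open>x\<close>. Otherwise, by transitivity, the ideal contributes no candidate and the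
  least one in \<open>C\<close> still serves.\<close>

lemma closure_system_Un_principal_ideal:
  assumes C: "closure_system P C" and y: "y \<in> carrier P"
  shows "closure_system P (C \<union> {z \<in> carrier P. z \<sqsubseteq> y})" (is "closure_system P ?C'")
proof -
  have sub: "C \<subseteq> carrier P"
    using C closure_system_iff_least by blast
  have "\<exists>c. least P c {z \<in> ?C'. x \<sqsubseteq> z}" if x: "x \<in> carrier P" for x
  proof (cases "x \<sqsubseteq> y")
    case True
    then have "least P x {z \<in> ?C'. x \<sqsubseteq> z}"
      using x sub by (auto simp: least_def)
    then show ?thesis ..
  next
    case False
    then have "{z \<in> ?C'. x \<sqsubseteq> z} = {z \<in> C. x \<sqsubseteq> z}"
      using le_trans x y by blast
    then show ?thesis
      using C x closure_system_iff_least by simp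
  qed
  then show ?thesis
    using sub closure_system_iff_least by blast
qed

text \<open>If \<open>y\<close> bounds \<open>D\<close>, it also bounds the join. Otherwise
  \<open>D\<close> has an element \<open>d\<close> not below \<open>y\<close>; the members of
  \<open>D\<close> above \<open>d\<close> avoid the ideal, so they lie in \<open>C\<close>, and
  being cofinal in \<open>D\<close> they have the same join.\<close>

lemma directed_closed_Un_principal_ideal:
  assumes C: "directed_closed P C" and y: "y \<in> carrier P"
  shows "directed_closed P (C \<union> {z \<in> carrier P. z \<sqsubseteq> y})" (is "directed_closed P ?C'")
  unfolding directed_closed_def
proof (intro conjI allI impI)
  show "?C' \<subseteq> carrier P"
    using C by (auto simp: directed_closed_def)
next
  fix D s
  assume "directed P D \<and> D \<subseteq> ?C' \<and> least P s (Upper P D)"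
  then have D: "directed P D" "D \<subseteq> ?C'" and s: "least P s (Upper P D)"
    by auto
  have Dc: "D \<subseteq> carrier P"
    using D by (simp add: directed_def)
  show "s \<in> ?C'"
  proof (cases "\<forall>d\<in>D. d \<sqsubseteq> y")
    case True
    then have "s \<sqsubseteq> y"
      using least_le[OF s, of y] y by (simp add: Upper_memI)
    then show ?thesis
      using s by simp
  next
    case False
    then obtain d where d: "d \<in> D" "\<not> d \<sqsubseteq> y"
      by blast
    let ?E = "{e \<in> D. d \<sqsubseteq> e}"
    have cofinal: "\<exists>e\<in>?E. x \<sqsubseteq> e" if "x \<in> D" for x
      using D d that unfolding directed_def by blast
    have "\<exists>z\<in>?E. a \<sqsubseteq> z \<and> b \<sqsubseteq> z" if ab: "a \<in> ?E" "b \<in> ?E" for a b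
    proof -
      obtain z where "z \<in> D" "a \<sqsubseteq> z" "b \<sqsubseteq> z"
        using D ab unfolding directed_def by blast
      moreover from this have "d \<sqsubseteq> z"
        using ab d Dc le_trans[of d a z] by (simp add: subset_iff)
      ultimately show ?thesis by blast
    qed
    moreover have "d \<in> ?E" "?E \<subseteq> carrier P"
      using d Dc by auto
    ultimately have "directed P ?E"
      unfolding directed_def by blast
    moreover have "?E \<subseteq> C"
    proof
      fix e assume e: "e \<in> ?E"
      then have "\<not> e \<sqsubseteq> y"
        using d y Dc le_trans[of d e y] by blast
      then show "e \<in> C"
        using e D by blast
    qed
    \<comment> \<open>Equal sets of upper bounds make \<open>s\<close> the join of \<open>?E\<close>
      too, so directed-closedness of \<open>C\<close> applies to \<open>s\<close> itself.\<close>
    moreover have "Upper P ?E = Upper P D"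
    proof
      show "Upper P ?E \<subseteq> Upper P D"
      proof
        fix u assume u: "u \<in> Upper P ?E"
        then have uc: "u \<in> carrier P" and ub: "\<And>e. e \<in> ?E \<Longrightarrow> e \<sqsubseteq> u"
          using Dc by (auto simp: Upper_def)
        have "x \<sqsubseteq> u" if x: "x \<in> D" for x
        proof -
          obtain e where "e \<in> ?E" "x \<sqsubseteq> e"
            using cofinal[OF x] by blast
          then show ?thesis
            using ub[of e] x uc Dc le_trans[of x e u] by blast
        qed
        then show "u \<in> Upper P D"
          using uc by (rule Upper_memI)
      qed
      show "Upper P D \<subseteq> Upper P ?E"
        by (rule Upper_antimono) auto
    qed
    ultimately have "s \<in> C"
      using C s unfolding directed_closed_def by metis
    then show ?thesis ..
  qed
qed

section \<open>Generated closures and anti-exchange\<close>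

text \<open>This isolates what both closures share: \<open>Q\<close> stands for being a closure
  system, with or without directed-closedness. The equation for \<open>cl\<close> has the shape of
  the definitions of \<open>clsys\<close> and \<open>dcclsys\<close>.\<close>

lemma convex_geometry_Least:
  fixes Q :: "'a set \<Rightarrow> bool"
  assumes sub: "\<And>C. Q C \<Longrightarrow> C \<subseteq> carrier P"
    and carr: "Q (carrier P)"
    and Inter: "\<And>F. F \<noteq> {} \<Longrightarrow> (\<And>C. C \<in> F \<Longrightarrow> Q C) \<Longrightarrow> Q (\<Inter>F)"
    and ideal: "\<And>C y. Q C \<Longrightarrow> y \<in> carrier P \<Longrightarrow> Q (C \<union> {z \<in> carrier P. z \<sqsubseteq> y})"
    and cl: "\<And>X. cl X = (LEAST C. Q C \<and> X \<subseteq> C)"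
  shows "convex_geometry (carrier P) cl"
proof -
  \<comment> \<open>For such \<open>X\<close> the family contains \<open>carrier P\<close>, so
    \<open>Inter\<close> applies and the \<open>LEAST\<close> is attained.\<close>
  have cl_Inter: "cl X = \<Inter>{C. Q C \<and> X \<subseteq> C}" if "X \<subseteq> carrier P" for X
    unfolding cl by (rule Least_equality) (use Inter[of "{C. Q C \<and> X \<subseteq> C}"] carr that in blast)+
  have Q: "Q (cl X)" if "X \<subseteq> carrier P" for X
    unfolding cl_Inter[OF that] by (rule Inter) (use carr that in blast)+
  have ext: "X \<subseteq> cl X" if "X \<subseteq> carrier P" for X
    using cl_Inter[OF that] by blast
  have least: "cl X \<subseteq> C" if "X \<subseteq> C" "Q C" for X C
    using cl_Inter[of X] sub that by blast
  \<comment> \<open>Needed because \<open>isotone\<close> includes the order axioms for its domain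
    and codomain.\<close>
  have wpo: "weak_partial_order (powerset_lattice (carrier P))"
    by unfold_locales (auto simp: powerset_lattice_def)
  have mono: "cl X \<subseteq> cl Y" if "X \<subseteq> Y" "Y \<subseteq> carrier P" for X Y
    using that by (intro least Q order_trans[OF _ ext])
  have idem: "cl (cl X) = cl X" if "X \<subseteq> carrier P" for X
  proof
    show "cl (cl X) \<subseteq> cl X"
      using least Q that by blast
    show "cl X \<subseteq> cl (cl X)"
      by (rule ext) (rule sub[OF Q[OF that]])
  qed
  have "closure_operator (powerset_lattice (carrier P)) cl"
    using Q sub ext mono idem wpo
    by (auto simp: closure_operator_def isotone_def idempotent_def powerset_lattice_def)
  moreover have below: "u \<sqsubseteq> v"
    if "A \<subseteq> carrier P" "v \<in> carrier P" "u \<notin> cl A" "u \<in> cl (A \<union> {v})" for A u v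
  proof -
    \<comment> \<open>By \<open>ideal\<close> the right-hand side satisfies \<open>Q\<close>, and it
      includes \<open>A\<close> and contains \<open>v\<close>.\<close>
    have "cl (A \<union> {v}) \<subseteq> cl A \<union> {z \<in> carrier P. z \<sqsubseteq> v}"
      by (rule least) (use that ext[of A] Q ideal in auto)
    then show ?thesis
      using that by blast
  qed
  \<comment> \<open>A failure would give \<open>x \<sqsubseteq> y\<close> and
    \<open>y \<sqsubseteq> x\<close> by \<open>below\<close>, against
    \<open>x \<noteq> y\<close>.\<close>
  have "anti_exchange (carrier P) cl"
    unfolding anti_exchange_def using below le_antisym by meson
  ultimately show ?thesis
    by (simp add: convex_geometry_def)
qed

lemma convex_geometry_clsys: "convex_geometry (carrier P) (clsys P)"
proof (rule convex_geometry_Least[where Q = "closure_system P"])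
  show "C \<subseteq> carrier P" if "closure_system P C" for C
    using that closure_system_iff_least by blast
qed (fact closure_system_carrier closure_system_Inter closure_system_Un_principal_ideal clsys_def)+

lemma convex_geometry_dcclsys: "convex_geometry (carrier P) (dcclsys P)"
proof (rule convex_geometry_Least[where Q = "\<lambda>C. closure_system P C \<and> directed_closed P C"])
  show "C \<subseteq> carrier P" if "closure_system P C \<and> directed_closed P C" for C
    using that by (simp add: directed_closed_def)
  show "closure_system P (carrier P) \<and> directed_closed P (carrier P)"
    by (simp add: closure_system_carrier directed_closed_carrier)
  show "closure_system P (\<Inter>F) \<and> directed_closed P (\<Inter>F)"
    if "F \<noteq> {}" "\<And>C. C \<in> F \<Longrightarrow> closure_system P C \<and> directed_closed P C" for F
    by (simp add: that closure_system_Inter directed_closed_Inter)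
  show "closure_system P (C \<union> {z \<in> carrier P. z \<sqsubseteq> y}) \<and>
      directed_closed P (C \<union> {z \<in> carrier P. z \<sqsubseteq> y})"
    if "closure_system P C \<and> directed_closed P C" "y \<in> carrier P" for C y
    using that closure_system_Un_principal_ideal directed_closed_Un_principal_ideal by blast
  show "dcclsys P X = (LEAST C. (closure_system P C \<and> directed_closed P C) \<and> X \<subseteq> C)" for X
    by (simp add: dcclsys_def conj_assoc)
qed

end

theorem proposition9p1:
  fixes P :: "('a, 'b) gorder_scheme"
  assumes "dcpo P"
  shows "convex_geometry (carrier P) (clsys P) \<and> convex_geometry (carrier P) (dcclsys P)"
  using dcpo.convex_geometry_clsys[OF assms] dcpo.convex_geometry_dcclsys[OF assms] ..

end
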